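(* Let $\phi$ be an instance of monotone 1-in-3 SAT with variables $x_1,\dots,x_n$ and clauses $C_1,\dots,C_m$, and let $G=(A\cup P,E)$ be the instance constructed from $\phi$ as described in the context. Then $G$ admits a matching that is popular among all feasible matchings if and only if $\phi$ has a satisfying 1-in-3 assignment (an assignment making exactly one variable of each clause true).
   Context: Monotone 1-in-3 SAT: each clause is a disjunction of exactly three distinct unnegated variables. Construction of $G$: applicants $A=\{a_i,b_i: 1\le i\le n\}\cup\{a_{ij},b_{ij}: x_i\in C_j\}$; posts $P=\{p_i,p^t_i,p^f_i:1\le i\le n\}\cup\{p_j: 1\le j\le m\}$ (clause posts $p_j$ distinct from variable posts $p_i$). Strict preference lists (first entry rank 1, second rank 2): $a_i: p_i, p^t_i$; $b_i: p_i, p^f_i$; $a_{ij}: p_j, p^t_i$; $b_{ij}: p_j,p^f_i$. Each applicant can be matched to at most one post. For a clause $C_j=x_i\vee x_{i'}\vee x_{i''}$, post $p_j$ has quota 3 and classes $\{a_{ij},b_{ij}\}$ with quota 1 for each variable $x_i$ of $C_j$, $\{a_{ij},a_{i'j},a_{i''j}\}$ with quota 1, and $\{b_{ij},b_{i'j},b_{i''j}\}$ with quota 2. With $k_i$ the number of occurrences of $x_i$ in $\phi$: $p^t_i$ has quota $k_i$ and classes $\{a_{ij},a_i\}$ with quota 1 for each $j$ with $x_i\in C_j$; $p^f_i$ has quota $k_i$ and classes $\{b_{ij},b_i\}$ with quota 1 for each $j$ with $x_i\in C_j$; $p_i$ has quota 1 and no classes. A matching $M\subseteq E$ is feasible if every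 post $p$ has $|M(p)|\le q(p)$ and $|M(p)\cap C|\le q(C)$ for each class $C$ of $p$. For feasible $M,M'$, applicant $a$ prefers $M$ to $M'$ if it ranks $M(a)$ strictly better than $M'(a)$ (being matched beats being unmatched); $M$ is more popular than $M'$ if more applicants prefer $M$ to $M'$ than vice versa; a feasible $M$ is popular among feasible matchings if no feasible matching is more popular than $M$. *)

theory Defs
  imports Main
begin

section \<open>Popular matchings with classified posts\<close>

text \<open>A class of a post is stored together with its quota, as a pair. Preference lists are strict
  and listed from most to least preferred.\<close>

record ('a, 'p) classified_instance =
  applicants :: "'a set"
  posts :: "'p set"
  pref :: "'a \<Rightarrow> 'p list"
  quota :: "'p \<Rightarrow> nat"
  classes :: "'p \<Rightarrow> ('a set \<times> nat) set"

definition edges :: "('a, 'p) classified_instance \<Rightarrow> ('a \<times> 'p) set" where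
  "edges G = {(a, p). a \<in> applicants G \<and> p \<in> posts G \<and> p \<in> set (pref G a)}"

text \<open>The 1-based position of a post in the list of an applicant; only meaningful on edges.\<close>

definition rank :: "('a, 'p) classified_instance \<Rightarrow> 'a \<Rightarrow> 'p \<Rightarrow> nat" where
  "rank G a p = Suc (length (takeWhile (\<lambda>p'. p' \<noteq> p) (pref G a)))"

definition is_matching :: "('a, 'p) classified_instance \<Rightarrow> ('a \<times> 'p) set \<Rightarrow> bool" where
  "is_matching G M \<longleftrightarrow> M \<subseteq> edges G \<and> (\<forall>a p p'. (a, p) \<in> M \<longrightarrow> (a, p') \<in> M \<longrightarrow> p = p')"

definition assigned :: "('a \<times> 'p) set \<Rightarrow> 'p \<Rightarrow> 'a set" where
  "assigned M p = {a. (a, p) \<in> M}"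

definition feasible :: "('a, 'p) classified_instance \<Rightarrow> ('a \<times> 'p) set \<Rightarrow> bool" where
  "feasible G M \<longleftrightarrow> is_matching G M \<and>
     (\<forall>p \<in> posts G. card (assigned M p) \<le> quota G p \<and>
        (\<forall>(D, k) \<in> classes G p. card (assigned M p \<inter> D) \<le> k))"

definition prefers ::
  "('a, 'p) classified_instance \<Rightarrow> 'a \<Rightarrow> ('a \<times> 'p) set \<Rightarrow> ('a \<times> 'p) set \<Rightarrow> bool" where
  "prefers G a M M' \<longleftrightarrow>
     (\<exists>p. (a, p) \<in> M \<and>
        ((\<nexists>p'. (a, p') \<in> M') \<or> (\<exists>p'. (a, p') \<in> M' \<and> rank G a p < rank G a p')))"

definition more_popular ::
  "('a, 'p) classified_instance \<Rightarrow> ('a \<times> 'p) set \<Rightarrow> ('a \<times> 'p) set \<Rightarrow> bool" where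
  "more_popular G M M' \<longleftrightarrow>
     card {a \<in> applicants G. prefers G a M M'} > card {a \<in> applicants G. prefers G a M' M}"

definition popular_among_feasible ::
  "('a, 'p) classified_instance \<Rightarrow> ('a \<times> 'p) set \<Rightarrow> bool" where
  "popular_among_feasible G M \<longleftrightarrow>
     feasible G M \<and> \<not> (\<exists>M'. feasible G M' \<and> more_popular G M' M)"

section \<open>Monotone 1-in-3 SAT\<close>

text \<open>The variables are the indices \<open>1, \<dots>, n\<close>, and \<open>C j\<close> is the set of (indices of) variables of
  the \<open>j\<close>-th clause, for \<open>1 \<le> j \<le> m\<close>. Clauses may be repeated and variables may be unused.\<close>

definition monotone_1in3_instance :: "nat \<Rightarrow> nat \<Rightarrow> (nat \<Rightarrow> nat set) \<Rightarrow> bool" where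
  "monotone_1in3_instance n m C \<longleftrightarrow> (\<forall>j \<in> {1..m}. C j \<subseteq> {1..n} \<and> card (C j) = 3)"

definition satisfies_1in3 :: "nat \<Rightarrow> (nat \<Rightarrow> nat set) \<Rightarrow> (nat \<Rightarrow> bool) \<Rightarrow> bool" where
  "satisfies_1in3 m C v \<longleftrightarrow> (\<forall>j \<in> {1..m}. \<exists>!i. i \<in> C j \<and> v i)"

section \<open>The reduction\<close>

text \<open>\<open>AVar i\<close>, \<open>BVar i\<close>, \<open>AOcc i j\<close>, \<open>BOcc i j\<close> stand for $a_i$, $b_i$, $a_{ij}$, $b_{ij}$, and
  \<open>PVar i\<close>, \<open>PTrue i\<close>, \<open>PFalse i\<close>, \<open>PClause j\<close> for $p_i$, $p^t_i$, $p^f_i$ and the clause post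
  $p_j$.\<close>

datatype applicant = AVar nat | BVar nat | AOcc nat nat | BOcc nat nat

datatype post = PVar nat | PTrue nat | PFalse nat | PClause nat

definition occurrences :: "nat \<Rightarrow> (nat \<Rightarrow> nat set) \<Rightarrow> nat \<Rightarrow> nat set" where
  "occurrences m C i = {j \<in> {1..m}. i \<in> C j}"

fun red_pref :: "applicant \<Rightarrow> post list" where
  "red_pref (AVar i) = [PVar i, PTrue i]"
| "red_pref (BVar i) = [PVar i, PFalse i]"
| "red_pref (AOcc i j) = [PClause j, PTrue i]"
| "red_pref (BOcc i j) = [PClause j, PFalse i]"

fun red_quota :: "nat \<Rightarrow> (nat \<Rightarrow> nat set) \<Rightarrow> post \<Rightarrow> nat" where
  "red_quota m C (PVar i) = 1"
| "red_quota m C (PTrue i) = card (occurrences m C i)"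
| "red_quota m C (PFalse i) = card (occurrences m C i)"
| "red_quota m C (PClause j) = 3"

fun red_classes :: "nat \<Rightarrow> (nat \<Rightarrow> nat set) \<Rightarrow> post \<Rightarrow> (applicant set \<times> nat) set" where
  "red_classes m C (PVar i) = {}"
| "red_classes m C (PTrue i) = {({AOcc i j, AVar i}, 1) | j. j \<in> occurrences m C i}"
| "red_classes m C (PFalse i) = {({BOcc i j, BVar i}, 1) | j. j \<in> occurrences m C i}"
| "red_classes m C (PClause j) =
     {({AOcc i j, BOcc i j}, 1) | i. i \<in> C j} \<union>
     {({AOcc i j | i. i \<in> C j}, 1), ({BOcc i j | i. i \<in> C j}, 2)}"

definition reduction ::
  "nat \<Rightarrow> nat \<Rightarrow> (nat \<Rightarrow> nat set) \<Rightarrow> (applicant, post) classified_instance" where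
  "reduction n m C = \<lparr>
     applicants = {AVar i | i. i \<in> {1..n}} \<union> {BVar i | i. i \<in> {1..n}} \<union>
       {AOcc i j | i j. j \<in> {1..m} \<and> i \<in> C j} \<union> {BOcc i j | i j. j \<in> {1..m} \<and> i \<in> C j},
     posts = {PVar i | i. i \<in> {1..n}} \<union> {PTrue i | i. i \<in> {1..n}} \<union> {PFalse i | i. i \<in> {1..n}} \<union>
       {PClause j | j. j \<in> {1..m}},
     pref = red_pref,
     quota = red_quota m C,
     classes = red_classes m C\<rparr>"

end

theory Submission
  imports Defs
begin

text \<open>Every applicant has exactly two posts, so a matching is a pair of disjoint sets \<open>F\<close>, \<open>S\<close>: the
  applicants at their first and at their second choice. In terms of \<open>F\<close> and \<open>S\<close> the quotas become
  Boolean conditions: at most one of $a_i, b_i$ and at most one of $a_{ij}, b_{ij}$ is in \<open>F\<close>, each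
  clause has at most one $a_{ij}$ in \<open>F\<close> and at least one $b_{ij}$ outside \<open>F\<close>, and if $a_i$ is
  in \<open>S\<close>, then no $a_{ij}$ is (similarly for $b$).

  A satisfying assignment yields a matching in which \<open>F\<close> is as large as possible and nobody outside
  \<open>F\<close> can be improved except by moving into \<open>F\<close>; such a matching is popular.

  Conversely, in a popular matching all first-choice posts are full, so each clause \<open>j\<close> selects one
  variable \<open>t j\<close>, the one with $a_{ij}$ in \<open>F\<close>. Replacing \<open>t\<close> by any other selection \<open>t'\<close> costs as
  many votes as it gains. If an unmatched $a_i$ or $b_i$ became able to take its second choice after
  such a replacement, this would be one additional vote. Hence the selections of the clauses agree
  with the assignment that makes $x_i$ true iff $b_i$ is at $p_i$.\<close>

section \<open>Matchings as pairs of applicant sets\<close>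

definition first_post :: "applicant \<Rightarrow> post" where
  "first_post x = red_pref x ! 0"

definition second_post :: "applicant \<Rightarrow> post" where
  "second_post x = red_pref x ! 1"

lemma first_post_simps [simp]:
  "first_post (AVar i) = PVar i" "first_post (BVar i) = PVar i"
  "first_post (AOcc i j) = PClause j" "first_post (BOcc i j) = PClause j"
  by (simp_all add: first_post_def)

lemma second_post_simps [simp]:
  "second_post (AVar i) = PTrue i" "second_post (BVar i) = PFalse i"
  "second_post (AOcc i j) = PTrue i" "second_post (BOcc i j) = PFalse i"
  by (simp_all add: second_post_def)

lemma red_pref_eq: "red_pref x = [first_post x, second_post x]"
  by (cases x) simp_all

lemma first_neq_second [simp]: "first_post x \<noteq> second_post x" "second_post x \<noteq> first_post x"
  by (cases x; simp)+

definition matching_of :: "applicant set \<Rightarrow> applicant set \<Rightarrow> (applicant \<times> post) set" where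
  "matching_of F S = {(x, first_post x) | x. x \<in> F} \<union> {(x, second_post x) | x. x \<in> S}"

lemma assigned_matching_of:
  "assigned (matching_of F S) (PVar i) = F \<inter> {AVar i, BVar i}"
  "assigned (matching_of F S) (PTrue i) = S \<inter> insert (AVar i) (range (AOcc i))"
  "assigned (matching_of F S) (PFalse i) = S \<inter> insert (BVar i) (range (BOcc i))"
  "assigned (matching_of F S) (PClause j) = F \<inter> (range (\<lambda>i. AOcc i j) \<union> range (\<lambda>i. BOcc i j))"
  unfolding assigned_def matching_of_def set_eq_iff
  by (intro allI; rename_tac x; case_tac x; auto)+

text \<open>Two applicants share a slot exactly when they are rivals for one place:
  \<open>AVar i\<close> and \<open>BVar i\<close> for the single place at \<open>PVar i\<close>,
  \<open>AOcc i j\<close> and \<open>BOcc i j\<close> through their class of quota 1 at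
  \<open>PClause j\<close>. Both restrictions together thus become injectivity of
  \<open>slot\<close> on \<open>F\<close>, and first choices can be counted by slots.\<close>

definition slot :: "applicant \<Rightarrow> nat + nat \<times> nat" where
  "slot x = (case x of AVar i \<Rightarrow> Inl i | BVar i \<Rightarrow> Inl i
     | AOcc i j \<Rightarrow> Inr (i, j) | BOcc i j \<Rightarrow> Inr (i, j))"

lemma slot_simps [simp]:
  "slot (AVar i) = Inl i" "slot (BVar i) = Inl i"
  "slot (AOcc i j) = Inr (i, j)" "slot (BOcc i j) = Inr (i, j)"
  by (simp_all add: slot_def)

lemma inj_on_slot_iff:
  "inj_on slot F \<longleftrightarrow> (\<forall>i. AVar i \<in> F \<longrightarrow> BVar i \<notin> F) \<and> (\<forall>i j. AOcc i j \<in> F \<longrightarrow> BOcc i j \<notin> F)"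
  (is "_ \<longleftrightarrow> ?R")
proof
  show "inj_on slot F \<Longrightarrow> ?R"
    by (auto dest: inj_onD[of slot F "AVar _" "BVar _"] inj_onD[of slot F "AOcc _ _" "BOcc _ _"])
  show "?R \<Longrightarrow> inj_on slot F"
    by (auto simp: inj_on_def slot_def split: applicant.splits)
qed

lemma card_le_one_iff: "finite D \<Longrightarrow> card D \<le> 1 \<longleftrightarrow> (\<forall>x \<in> D. \<forall>y \<in> D. x = y)"
  by (simp add: card_le_Suc0_iff_eq)

section \<open>Feasibility and votes in terms of \<open>F\<close> and \<open>S\<close>\<close>

locale reduction_instance =
  fixes n m :: nat and C :: "nat \<Rightarrow> nat set"
  assumes inst: "monotone_1in3_instance n m C"
begin

abbreviation "G \<equiv> reduction n m C"
abbreviation "A \<equiv> applicants (reduction n m C)"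

lemma clause_var: "j \<in> {1..m} \<Longrightarrow> i \<in> C j \<Longrightarrow> i \<in> {1..n}"
  and clause_card: "j \<in> {1..m} \<Longrightarrow> card (C j) = 3"
  using inst unfolding monotone_1in3_instance_def by blast+

lemma mem_applicants [simp]:
  "AVar i \<in> A \<longleftrightarrow> i \<in> {1..n}" "BVar i \<in> A \<longleftrightarrow> i \<in> {1..n}"
  "AOcc i j \<in> A \<longleftrightarrow> j \<in> {1..m} \<and> i \<in> C j" "BOcc i j \<in> A \<longleftrightarrow> j \<in> {1..m} \<and> i \<in> C j"
  by (auto simp: reduction_def)

lemma finite_applicants: "finite A"
proof -
  have "A \<subseteq> AVar ` {1..n} \<union> BVar ` {1..n} \<union> (\<lambda>(i, j). AOcc i j) ` ({1..n} \<times> {1..m})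
      \<union> (\<lambda>(i, j). BOcc i j) ` ({1..n} \<times> {1..m})"
    using clause_var by (fastforce simp: reduction_def)
  then show ?thesis
    by (rule finite_subset) blast
qed

lemma posts_of_applicant:
  assumes "x \<in> A"
  shows "first_post x \<in> posts G" "second_post x \<in> posts G"
  using assms clause_var by (cases x; force simp: reduction_def)+

lemma mem_edges: "(x, p) \<in> edges G \<longleftrightarrow> x \<in> A \<and> (p = first_post x \<or> p = second_post x)"
  using posts_of_applicant[of x] by (auto simp: edges_def red_pref_eq reduction_def)

lemma rank_simps [simp]: "rank G x (first_post x) = 1" "rank G x (second_post x) = 2"
  by (simp_all add: rank_def red_pref_eq reduction_def)

text \<open>The condition on \<open>occurrences\<close> reflects that \<open>PTrue i\<close> and
  \<open>PFalse i\<close> have quota 0 if the variable occurs nowhere. Otherwise their quotas hold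
  automatically: \<open>AVar i\<close> or \<open>BVar i\<close> is there alone, or only occurrence
  applicants are there. Quota 3 of a clause post follows from injectivity of \<open>slot\<close>,
  and quota 2 of its \<open>BOcc\<close> class means that one of the three is outside
  \<open>F\<close>.\<close>

definition admissible :: "applicant set \<Rightarrow> applicant set \<Rightarrow> bool" where
  "admissible F S \<longleftrightarrow> F \<subseteq> A \<and> S \<subseteq> A \<and> F \<inter> S = {} \<and> inj_on slot F \<and>
     (\<forall>i. AVar i \<in> S \<longrightarrow> occurrences m C i \<noteq> {} \<and> (\<forall>j. AOcc i j \<notin> S)) \<and>
     (\<forall>i. BVar i \<in> S \<longrightarrow> occurrences m C i \<noteq> {} \<and> (\<forall>j. BOcc i j \<notin> S)) \<and>
     (\<forall>i i' j. AOcc i j \<in> F \<longrightarrow> AOcc i' j \<in> F \<longrightarrow> i = i') \<and>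
     (\<forall>j \<in> {1..m}. \<exists>i \<in> C j. BOcc i j \<notin> F)"

text \<open>A first choice beats everything but a first choice; a second choice beats only being
  unmatched.\<close>

lemma prefers_matching_of:
  assumes "admissible F S" "admissible F' S'"
  shows "{x \<in> A. prefers G x (matching_of F S) (matching_of F' S')} = (F - F') \<union> (S - F' - S')"
  using assms by (auto simp: admissible_def prefers_def matching_of_def)

lemma finite_occurrences: "finite (occurrences m C i)"
  by (simp add: occurrences_def)

lemma feasible_matching_of:
  assumes adm: "admissible F S"
  shows "feasible G (matching_of F S)"
proof -
  note adm' = adm[unfolded admissible_def inj_on_slot_iff]
  have FA: "F \<subseteq> A" and SA: "S \<subseteq> A" and disj: "F \<inter> S = {}" and inj: "inj_on slot F"
    using adm by (auto simp: admissible_def)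
  have "is_matching G (matching_of F S)"
    unfolding is_matching_def using FA SA disj
    by (auto simp: matching_of_def mem_edges)
  moreover have "card (assigned (matching_of F S) p) \<le> quota G p \<and>
      (\<forall>(D, k) \<in> classes G p. card (assigned (matching_of F S) p \<inter> D) \<le> k)" if "p \<in> posts G" for p
  proof (cases p)
    case (PVar i)
    have "card (F \<inter> {AVar i, BVar i}) \<le> 1"
      using adm' by (subst card_le_one_iff) auto
    with PVar show ?thesis
      by (simp add: assigned_matching_of reduction_def)
  next
    case (PTrue i)
    let ?D = "S \<inter> insert (AVar i) (range (AOcc i))"
    have "card ?D \<le> card (occurrences m C i)"
    proof (cases "AVar i \<in> S")
      case True
      then have "?D = {AVar i}" "occurrences m C i \<noteq> {}"
        using adm' by auto
      then show ?thesis
        using finite_occurrences by (simp add: Suc_le_eq card_gt_0_iff)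
    next
      case False
      then have "?D \<subseteq> AOcc i ` occurrences m C i"
        using SA by (auto simp: occurrences_def)
      then show ?thesis
        using finite_occurrences by (rule surj_card_le[rotated])
    qed
    moreover have "card (?D \<inter> {AOcc i j, AVar i}) \<le> 1" for j
      using adm' by (subst card_le_one_iff) auto
    ultimately show ?thesis
      using PTrue by (auto simp: assigned_matching_of reduction_def)
  next
    case (PFalse i)
    let ?D = "S \<inter> insert (BVar i) (range (BOcc i))"
    have "card ?D \<le> card (occurrences m C i)"
    proof (cases "BVar i \<in> S")
      case True
      then have "?D = {BVar i}" "occurrences m C i \<noteq> {}"
        using adm' by auto
      then show ?thesis
        using finite_occurrences by (simp add: Suc_le_eq card_gt_0_iff)
    next
      case False
      then have "?D \<subseteq> BOcc i ` occurrences m C i"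
        using SA by (auto simp: occurrences_def)
      then show ?thesis
        using finite_occurrences by (rule surj_card_le[rotated])
    qed
    moreover have "card (?D \<inter> {BOcc i j, BVar i}) \<le> 1" for j
      using adm' by (subst card_le_one_iff) auto
    ultimately show ?thesis
      using PFalse by (auto simp: assigned_matching_of reduction_def)
  next
    case (PClause j)
    then have j: "j \<in> {1..m}"
      using that by (auto simp: reduction_def)
    then have fin: "finite (C j)"
      using clause_card[OF j] card.infinite by fastforce
    let ?D = "F \<inter> (range (\<lambda>i. AOcc i j) \<union> range (\<lambda>i. BOcc i j))"
    \<comment> \<open>At most one applicant per slot \<open>(i, j)\<close> is at the post, and the
      clause has only three such slots.\<close>
    have "card ?D = card (slot ` ?D)"
      using inj by (simp add: card_image inj_on_subset)
    also have "\<dots> \<le> card ((\<lambda>i. Inr (i, j) :: nat + nat \<times> nat) ` C j)"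
      using FA fin by (intro card_mono) auto
    also have "\<dots> \<le> 3"
      using card_image_le[OF fin] clause_card[OF j] by metis
    finally have "card ?D \<le> 3" .
    moreover have "card (?D \<inter> {AOcc i j, BOcc i j}) \<le> 1" for i
      using adm' by (subst card_le_one_iff) auto
    moreover have "card (?D \<inter> {AOcc i j | i. i \<in> C j}) \<le> 1"
      using adm' fin by (subst card_le_one_iff) auto
    moreover have "card (?D \<inter> {BOcc i j | i. i \<in> C j}) \<le> 2"
    proof -
      obtain i where i: "i \<in> C j" "BOcc i j \<notin> F"
        using adm j unfolding admissible_def by blast
      have "?D \<inter> {BOcc i j | i. i \<in> C j} \<subseteq> (\<lambda>i. BOcc i j) ` (C j - {i})"
        using i by auto
      then have "card (?D \<inter> {BOcc i j | i. i \<in> C j}) \<le> card (C j - {i})"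
        using fin by (intro surj_card_le) auto
      then show ?thesis
        using i fin clause_card[OF j] by simp
    qed
    ultimately show ?thesis
      using PClause by (auto simp: assigned_matching_of reduction_def)
  qed
  ultimately show ?thesis
    unfolding feasible_def by blast
qed

lemma feasible_imp_matching_of:
  assumes feas: "feasible G M"
  obtains F S where "admissible F S" "M = matching_of F S"
proof
  let ?F = "{x. (x, first_post x) \<in> M}" and ?S = "{x. (x, second_post x) \<in> M}"
  have sub: "M \<subseteq> edges G" and fn: "\<And>x p p'. (x, p) \<in> M \<Longrightarrow> (x, p') \<in> M \<Longrightarrow> p = p'"
    using feas by (auto simp: feasible_def is_matching_def)
  show M: "M = matching_of ?F ?S"
    using sub mem_edges by (auto simp: matching_of_def)
  have FA: "?F \<subseteq> A" and SA: "?S \<subseteq> A"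
    using sub mem_edges by auto
  have quota: "card (assigned M p) \<le> quota G p" if "p \<in> posts G" for p
    using feas that by (auto simp: feasible_def)
  have class_quota: "card (assigned M p \<inter> D) \<le> k" if "p \<in> posts G" "(D, k) \<in> classes G p" for p D k
    using feas that by (fastforce simp: feasible_def)
  \<comment> \<open>An infinite set has \<open>card\<close> 0, so the quotas restrict
    \<open>M\<close> only once finiteness is known.\<close>
  have fin: "finite (assigned M p \<inter> D)" for p D
    by (rule finite_subset[OF _ finite_applicants]) (use sub mem_edges in \<open>auto simp: assigned_def\<close>)
  have at_most_one: "x = y" if "p \<in> posts G" "(D, 1) \<in> classes G p" "x \<in> D" "y \<in> D"
    "(x, p) \<in> M" "(y, p) \<in> M" for p D x y
    using class_quota[OF that(1,2)] card_le_one_iff[OF fin, of p D] that by (auto simp: assigned_def)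
  have post: "p \<in> posts G" if "(x, p) \<in> M" for x p
    using that sub by (auto simp: edges_def)
  have PVar: False if "(AVar i, PVar i) \<in> M" "(BVar i, PVar i) \<in> M" for i
  proof -
    have "card (assigned M (PVar i)) \<le> 1"
      using quota[OF post[OF that(1)]] by (simp add: reduction_def)
    then show False
      using card_le_one_iff[OF fin, of "PVar i" UNIV] that by (auto simp: assigned_def)
  qed
  \<comment> \<open>The classes of quota 1 exist only for actual occurrences; this fact supplies the
    class needed in \<open>AT\<close>, \<open>BF\<close>, \<open>AB\<close> and
    \<open>AA\<close>.\<close>
  have occ: "j \<in> occurrences m C i" if "(AOcc i j, p) \<in> M \<or> (BOcc i j, p) \<in> M" for i j p
  proof -
    have "AOcc i j \<in> A \<or> BOcc i j \<in> A"
      using that sub mem_edges by blast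
    then show ?thesis
      by (auto simp: occurrences_def)
  qed
  have nonempty: "occurrences m C i \<noteq> {}"
    if "(x, p) \<in> M" "p = PTrue i \<or> p = PFalse i" for x p i
  proof
    assume "occurrences m C i = {}"
    then have "card (assigned M p) = 0"
      using quota[OF post[OF that(1)]] that(2) by (auto simp: reduction_def)
    then show False
      using fin[of p UNIV] that(1) by (auto simp: assigned_def)
  qed
  have AT: False if "(AVar i, PTrue i) \<in> M" "(AOcc i j, PTrue i) \<in> M" for i j
    using at_most_one[OF post[OF that(1)], of "{AOcc i j, AVar i}" "AVar i" "AOcc i j"] that occ
    by (auto simp: reduction_def)
  have BF: False if "(BVar i, PFalse i) \<in> M" "(BOcc i j, PFalse i) \<in> M" for i j
    using at_most_one[OF post[OF that(1)], of "{BOcc i j, BVar i}" "BVar i" "BOcc i j"] that occ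
    by (auto simp: reduction_def)
  have AB: False if "(AOcc i j, PClause j) \<in> M" "(BOcc i j, PClause j) \<in> M" for i j
    using at_most_one[OF post[OF that(1)], of "{AOcc i j, BOcc i j}" "AOcc i j" "BOcc i j"]
      that occ[of i j] by (auto simp: reduction_def occurrences_def)
  have AA: "i = i'" if "(AOcc i j, PClause j) \<in> M" "(AOcc i' j, PClause j) \<in> M" for i i' j
    using at_most_one[OF post[OF that(1)], of "{AOcc i j | i. i \<in> C j}" "AOcc i j" "AOcc i' j"]
      that occ[of i j] occ[of i' j] by (auto simp: reduction_def occurrences_def)
  have BB: "\<exists>i \<in> C j. (BOcc i j, PClause j) \<notin> M" if j: "j \<in> {1..m}" for j
  proof (rule ccontr)
    assume "\<not> ?thesis"
    then have "assigned M (PClause j) \<inter> {BOcc i j | i. i \<in> C j} = (\<lambda>i. BOcc i j) ` C j"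
      by (auto simp: assigned_def)
    moreover have "card ((\<lambda>i. BOcc i j) ` C j) = 3"
      using clause_card[OF j] by (subst card_image) (auto simp: inj_on_def)
    ultimately show False
      using class_quota[of "PClause j" "{BOcc i j | i. i \<in> C j}" 2] j by (auto simp: reduction_def)
  qed
  have "inj_on slot ?F"
    unfolding inj_on_slot_iff using PVar AB by auto
  moreover have "?F \<inter> ?S = {}"
    using fn first_neq_second by blast
  ultimately show "admissible ?F ?S"
    unfolding admissible_def using FA SA AT BF AA BB nonempty by auto
qed

text \<open>Admissible pairs describe exactly the feasible matchings, so both quantifiers over
  matchings can range over pairs, with the votes counted by
  \<open>prefers_matching_of\<close>.\<close>

lemma ex_popular_iff:
  "(\<exists>M. popular_among_feasible G M) \<longleftrightarrow>
   (\<exists>F S. admissible F S \<and> (\<forall>F' S'. admissible F' S' \<longrightarrow>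
      card ((F' - F) \<union> (S' - F - S)) \<le> card ((F - F') \<union> (S - F' - S'))))"
  (is "_ \<longleftrightarrow> (\<exists>F S. admissible F S \<and> ?opt F S)")
proof -
  have "popular_among_feasible G (matching_of F S) \<longleftrightarrow> ?opt F S" if "admissible F S" for F S
  proof -
    have "more_popular G (matching_of F' S') (matching_of F S) \<longleftrightarrow>
        \<not> card ((F' - F) \<union> (S' - F - S)) \<le> card ((F - F') \<union> (S - F' - S'))"
      if "admissible F' S'" for F' S'
      using prefers_matching_of \<open>admissible F S\<close> that by (simp add: more_popular_def not_le)
    then show ?thesis
      unfolding popular_among_feasible_def
      by (metis feasible_matching_of feasible_imp_matching_of that)
  qed
  then show ?thesis
    by (metis feasible_imp_matching_of popular_among_feasible_def)
qed

text \<open>Since \<open>slot\<close> is injective on both sets, covering the slots gives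
  \<open>card F' \<le> card F\<close>, and removing the common part keeps the inequality. It is used
  in both directions of the equivalence.\<close>

lemma card_Diff_le_if_slots_covered:
  assumes "admissible F S" "admissible F' S'" "slot ` F' \<subseteq> slot ` F"
  shows "card (F' - F) \<le> card (F - F')"
proof -
  have fin: "finite F" "finite F'"
    using assms finite_applicants by (auto simp: admissible_def intro: finite_subset)
  have "card F' = card (slot ` F')"
    using assms by (simp add: admissible_def card_image)
  also have "\<dots> \<le> card F"
    using surj_card_le[OF fin(1) assms(3)] card_image_le[OF fin(1), of slot] card_mono assms(3) fin
    by (meson finite_imageI le_trans)
  finally show ?thesis
    using fin by (metis card_le_sym_Diff)
qed

section \<open>From a satisfying assignment to a popular matching\<close>

lemma satisfiable_imp_optimal:
  assumes sat: "satisfies_1in3 m C v"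
  shows "\<exists>F S. admissible F S \<and> (\<forall>F' S'. admissible F' S' \<longrightarrow>
      card ((F' - F) \<union> (S' - F - S)) \<le> card ((F - F') \<union> (S - F' - S')))"
proof -
  \<comment> \<open>For a true variable, \<open>BVar i\<close> and all \<open>AOcc i j\<close> get
    their first choice, while \<open>AVar i\<close> and all \<open>BOcc i j\<close> are sent to the
    different posts \<open>PTrue i\<close> and \<open>PFalse i\<close>. For a false variable the
    roles are exchanged, so no class of a second post is violated.\<close>
  define first where "first x = (case x of AVar i \<Rightarrow> \<not> v i | BVar i \<Rightarrow> v i
      | AOcc i j \<Rightarrow> v i | BOcc i j \<Rightarrow> \<not> v i)" for x
  \<comment> \<open>Excludes the applicants whose second post has quota 0; they remain unmatched if
    they miss their first choice.\<close>
  define used where "used x = (case x of AVar i \<Rightarrow> occurrences m C i \<noteq> {}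
      | BVar i \<Rightarrow> occurrences m C i \<noteq> {} | _ \<Rightarrow> True)" for x
  define F where "F = {x \<in> A. first x}"
  define S where "S = {x \<in> A. \<not> first x \<and> used x}"
  have ex: "\<exists>i \<in> C j. v i" and uniq: "i \<in> C j \<Longrightarrow> i' \<in> C j \<Longrightarrow> v i \<Longrightarrow> v i' \<Longrightarrow> i = i'"
    if "j \<in> {1..m}" for i i' j
    using sat that unfolding satisfies_1in3_def by blast+
  have adm: "admissible F S"
    unfolding admissible_def inj_on_slot_iff
    using ex uniq by (auto simp: F_def S_def first_def used_def)
  moreover have "card ((F' - F) \<union> (S' - F - S)) \<le> card ((F - F') \<union> (S - F' - S'))"
    if adm': "admissible F' S'" for F' S'
  proof -
    \<comment> \<open>Whoever can hold a second choice in any admissible pair is already matched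
      here, so votes are gained only by moving into \<open>F'\<close>.\<close>
    have "used x" if "x \<in> S'" for x
      using adm' that by (cases x) (auto simp: admissible_def used_def)
    then have no_gain: "S' - F - S = {}"
      using adm' by (auto simp: F_def S_def admissible_def)
    have "slot x \<in> slot ` F" if "x \<in> A" for x
    proof -
      \<comment> \<open>\<open>y\<close> is the rival of \<open>x\<close>; exactly one of the two
        satisfies \<open>first\<close>, so \<open>F\<close> fills every slot.\<close>
      define y where "y = (case x of AVar i \<Rightarrow> BVar i | BVar i \<Rightarrow> AVar i
        | AOcc i j \<Rightarrow> BOcc i j | BOcc i j \<Rightarrow> AOcc i j)"
      have "slot y = slot x" "x \<in> F \<or> y \<in> F"
        using that by (cases x; simp add: y_def F_def first_def)+
      then show ?thesis
        by (metis imageI)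
    qed
    then have "slot ` F' \<subseteq> slot ` F"
      using adm' by (auto simp: admissible_def)
    then have "card (F' - F) \<le> card (F - F')"
      using adm adm' card_Diff_le_if_slots_covered by blast
    moreover have "card (F - F') \<le> card ((F - F') \<union> (S - F' - S'))"
      using finite_applicants by (intro card_mono) (auto simp: F_def S_def)
    ultimately show ?thesis
      unfolding no_gain by simp
  qed
  ultimately show ?thesis
    by blast
qed

section \<open>From a popular matching to a satisfying assignment\<close>

lemma optimal_imp_satisfiable:
  assumes adm: "admissible F S"
    and opt: "\<And>F' S'. admissible F' S' \<Longrightarrow>
      card ((F' - F) \<union> (S' - F - S)) \<le> card ((F - F') \<union> (S - F' - S'))"
  shows "\<exists>v. satisfies_1in3 m C v"
proof -
  note adm' = adm[unfolded admissible_def inj_on_slot_iff]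
  have FA: "F \<subseteq> A" and SA: "S \<subseteq> A"
    using adm by (auto simp: admissible_def)
  \<comment> \<open>Moving \<open>x\<close> alone to its first choice would gain one vote and lose
    none.\<close>
  have no_insert: False if "x \<notin> F" "admissible (insert x F) (S - {x})" for x
  proof -
    have "(insert x F - F) \<union> (S - {x} - F - S) = {x}" and
      loss: "(F - insert x F) \<union> (S - insert x F - (S - {x})) = {}"
      using that by auto
    then show False
      using opt[OF that(2)] unfolding loss by simp
  qed
  have var_full: "AVar i \<in> F \<or> BVar i \<in> F" if "i \<in> {1..n}" for i
  proof (rule ccontr)
    assume *: "\<not> ?thesis"
    have "admissible (insert (AVar i) F) (S - {AVar i})"
      using adm' * that unfolding admissible_def inj_on_slot_iff by auto
    with * show False
      using no_insert by blast
  qed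
  have clause_full: "AOcc i j \<in> F \<or> BOcc i j \<in> F" if j: "j \<in> {1..m}" and i: "i \<in> C j" for i j
  proof (rule ccontr)
    assume *: "\<not> ?thesis"
    show False
    proof (cases "\<exists>i'. AOcc i' j \<in> F")
      \<comment> \<open>The \<open>AOcc\<close> class is full, so \<open>BOcc i j\<close> is
        inserted. Its bound survives because \<open>BOcc i' j\<close>, the rival of
        \<open>AOcc i' j\<close>, stays outside \<open>F\<close>.\<close>
      case True
      then obtain i' where i': "AOcc i' j \<in> F"
        by blast
      then have "i' \<in> C j" "BOcc i' j \<notin> F" "i' \<noteq> i"
        using adm' * by auto
      then have "\<exists>k \<in> C j'. BOcc k j' \<notin> insert (BOcc i j) F" if "j' \<in> {1..m}" for j'
        using adm' that by (cases "j' = j") auto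
      then have "admissible (insert (BOcc i j) F) (S - {BOcc i j})"
        using adm' * i j unfolding admissible_def inj_on_slot_iff by auto
      with * show False
        using no_insert by blast
    next
      case False
      then have "admissible (insert (AOcc i j) F) (S - {AOcc i j})"
        using adm' * i j unfolding admissible_def inj_on_slot_iff by auto
      with * show False
        using no_insert by blast
    qed
  qed
  \<comment> \<open>Keeps the variable posts as in \<open>F\<close> and refills each clause post:
    the \<open>AOcc\<close> applicant of the variable \<open>t j\<close>, the \<open>BOcc\<close>
    applicants of the others.\<close>
  define select where "select t = {x \<in> A. case x of AOcc i j \<Rightarrow> t j = i | BOcc i j \<Rightarrow> t j \<noteq> i
      | _ \<Rightarrow> x \<in> F}" for t :: "nat \<Rightarrow> nat"
  have mem_select [simp]: "AVar i \<in> select t \<longleftrightarrow> AVar i \<in> F" "BVar i \<in> select t \<longleftrightarrow> BVar i \<in> F"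
    "AOcc i j \<in> select t \<longleftrightarrow> j \<in> {1..m} \<and> i \<in> C j \<and> t j = i"
    "BOcc i j \<in> select t \<longleftrightarrow> j \<in> {1..m} \<and> i \<in> C j \<and> t j \<noteq> i" for i j t
    using FA by (auto simp: select_def simp del: mem_applicants) (auto)
  have select_sub: "select t \<subseteq> A" for t
    by (auto simp: select_def)
  \<comment> \<open>\<open>select t\<close> fills every slot that \<open>F\<close> fills, so the
    first choices gain at least as many votes as they lose. Applicants displaced from
    \<open>F\<close> vote against the change even if given a second choice, so none is given to
    them. The unmatched \<open>z\<close> then adds one decisive vote.\<close>
  have no_swap: False
    if "z \<in> A" "z \<notin> F" "z \<notin> S" "z \<notin> select t" "admissible (select t) (insert z (S - select t))"
    for z t
  proof -
    let ?F' = "select t" and ?S' = "insert z (S - select t)"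
    have "slot x \<in> slot ` ?F'" if "x \<in> F" for x
    proof -
      define y where "y = (case x of AVar i \<Rightarrow> BVar i | BVar i \<Rightarrow> AVar i
        | AOcc i j \<Rightarrow> BOcc i j | BOcc i j \<Rightarrow> AOcc i j)"
      have "slot y = slot x" "x \<in> ?F' \<or> y \<in> ?F'"
        using that FA by (cases x; auto simp: y_def)+
      then show ?thesis
        by (metis imageI)
    qed
    then have "card (F - ?F') \<le> card (?F' - F)"
      using adm that card_Diff_le_if_slots_covered by blast
    moreover have "(?F' - F) \<union> (?S' - F - S) = insert z (?F' - F)"
      "(F - ?F') \<union> (S - ?F' - ?S') = F - ?F'"
      using that by auto
    moreover have "finite (?F' - F)"
      using finite_applicants select_sub finite_subset by blast
    ultimately show False
      using opt[OF that(5)] that by simp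
  qed
  have A_imp: "AVar i \<notin> F" if a: "AOcc i j \<in> F" for i j
  proof
    assume var: "AVar i \<in> F"
    then have b: "BVar i \<notin> F" "BOcc i j \<notin> F" and occ: "j \<in> {1..m}" "i \<in> C j" and i: "i \<in> {1..n}"
      using adm' a FA by auto
    show False
    proof (cases "BVar i \<in> S")
      case True
      \<comment> \<open>\<open>BVar i\<close> moves up to \<open>PVar i\<close>, which frees
        \<open>PFalse i\<close> for the unmatched \<open>BOcc i j\<close>: two votes against the one
        of \<open>AVar i\<close>.\<close>
      let ?F' = "insert (BVar i) (F - {AVar i})" and ?S' = "insert (BOcc i j) (S - {BVar i})"
      have "BOcc i j \<notin> S"
        using adm' True by blast
      then have "(?F' - F) \<union> (?S' - F - S) = {BVar i, BOcc i j}"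
        "(F - ?F') \<union> (S - ?F' - ?S') = {AVar i}"
        using var b True by auto
      moreover have "admissible ?F' ?S'"
        using adm' b occ i True unfolding admissible_def inj_on_slot_iff by auto
      ultimately show False
        using opt[of ?F' ?S'] by simp
    next
      case False
      \<comment> \<open>Now \<open>BVar i\<close> is unmatched. A selection \<open>t\<close>
        avoiding \<open>i\<close> in every clause puts all \<open>BOcc i j'\<close> at clause posts,
        so \<open>BVar i\<close> can take \<open>PFalse i\<close>.\<close>
      have "\<exists>k. k \<in> C j' \<and> k \<noteq> i" if "j' \<in> {1..m}" for j'
      proof -
        have "\<not> C j' \<subseteq> {i}"
          using clause_card[OF that] card_mono[of "{i}" "C j'"] by auto
        then show ?thesis
          by auto
      qed
      then obtain t where t: "\<And>j'. j' \<in> {1..m} \<Longrightarrow> t j' \<in> C j' \<and> t j' \<noteq> i"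
        by metis
      have "BOcc i j' \<notin> S - select t" for j'
        using SA t[of j'] by auto
      moreover have "\<exists>k \<in> C j'. BOcc k j' \<notin> select t" if "j' \<in> {1..m}" for j'
        using t[OF that] by auto
      moreover have "occurrences m C i \<noteq> {}"
        using occ by (auto simp: occurrences_def)
      ultimately have "admissible (select t) (insert (BVar i) (S - select t))"
        using adm' select_sub b i unfolding admissible_def inj_on_slot_iff by auto
      then show False
        using no_swap[of "BVar i" t] b i False by simp
    qed
  qed
  have B_imp: "BVar i \<notin> F" if b: "BOcc i j \<in> F" for i j
  proof
    assume var: "BVar i \<in> F"
    then have a: "AVar i \<notin> F" "AOcc i j \<notin> F" and occ: "j \<in> {1..m}" "i \<in> C j" and i: "i \<in> {1..n}"
      using adm' b FA by auto
    show False
    proof (cases "AVar i \<in> S")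
      case True
      \<comment> \<open>The mirror image: \<open>AVar i\<close> moves up and frees
        \<open>PTrue i\<close> for the unmatched \<open>AOcc i j\<close>, at the cost of
        \<open>BVar i\<close> only.\<close>
      let ?F' = "insert (AVar i) (F - {BVar i})" and ?S' = "insert (AOcc i j) (S - {AVar i})"
      have "AOcc i j \<notin> S"
        using adm' True by blast
      then have "(?F' - F) \<union> (?S' - F - S) = {AVar i, AOcc i j}"
        "(F - ?F') \<union> (S - ?F' - ?S') = {BVar i}"
        using var a True by auto
      moreover have "admissible ?F' ?S'"
        using adm' a occ i True unfolding admissible_def inj_on_slot_iff by auto
      ultimately show False
        using opt[of ?F' ?S'] by simp
    next
      case False
      \<comment> \<open>Here \<open>t\<close> selects \<open>i\<close> wherever it occurs, so all
        \<open>AOcc i j'\<close> are at clause posts and the unmatched \<open>AVar i\<close> can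
        take \<open>PTrue i\<close>.\<close>
      have "\<exists>k. k \<in> C j' \<and> (i \<in> C j' \<longrightarrow> k = i)" if "j' \<in> {1..m}" for j'
        using clause_card[OF that] by (metis card.empty ex_in_conv zero_neq_numeral)
      then obtain t where t: "\<And>j'. j' \<in> {1..m} \<Longrightarrow> t j' \<in> C j' \<and> (i \<in> C j' \<longrightarrow> t j' = i)"
        by metis
      have "admissible (select t) (insert (AVar i) (S - select t))"
        using adm' select_sub a occ i t unfolding admissible_def inj_on_slot_iff
        by (auto simp: occurrences_def)
      then show False
        using no_swap[of "AVar i" t] a i False by simp
    qed
  qed
  have "\<exists>!i. i \<in> C j \<and> BVar i \<in> F" if j: "j \<in> {1..m}" for j
  proof -
    \<comment> \<open>Some \<open>BOcc i j\<close> is outside \<open>F\<close>, so its rival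
      \<open>AOcc i j\<close> is in \<open>F\<close>. By \<open>A_imp\<close>, \<open>B_imp\<close>
      and full slots, \<open>AOcc k j\<close> is in \<open>F\<close> exactly when
      \<open>BVar k\<close> is; uniqueness is the quota 1 of the \<open>AOcc\<close> class.\<close>
    obtain i where "i \<in> C j" "AOcc i j \<in> F"
      using adm' clause_full j by metis
    moreover have "AOcc k j \<in> F \<longleftrightarrow> BVar k \<in> F" if "k \<in> C j" for k
      using A_imp B_imp var_full clause_full clause_var j that by meson
    ultimately show ?thesis
      using adm' by metis
  qed
  then have "satisfies_1in3 m C (\<lambda>i. BVar i \<in> F)"
    by (simp add: satisfies_1in3_def)
  then show ?thesis
    by blast
qed

end

theorem theorem6:
  fixes n m :: nat and C :: "nat \<Rightarrow> nat set"
  assumes "monotone_1in3_instance n m C"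
  shows "(\<exists>M. popular_among_feasible (reduction n m C) M) \<longleftrightarrow> (\<exists>v. satisfies_1in3 m C v)"
proof -
  interpret reduction_instance n m C
    by standard (fact assms)
  show ?thesis
    unfolding ex_popular_iff
    using satisfiable_imp_optimal optimal_imp_satisfiable by blast
qed

end
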